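(* Let $k\ge1$ and let $c_1,\dots,c_k$ be non-negative integers with $c_k>0$ and $\gcd\{m : c_m\neq 0\}=1$; let $P(x)=x^k-c_1x^{k-1}-\cdots-c_k$ and let $r$ be its principal root. Let $\{a_n\}_{n\ge1}$ be a sequence of real numbers with arbitrary real initial values $a_1,\dots,a_k$ satisfying $a_{n+1}=c_1a_n+c_2a_{n-1}+\cdots+c_ka_{n+1-k}$ for all $n\ge k$. Consider the Binet expansion of $\{a_n\}$. Then the sign of the coefficient attached to $r^n$ equals the sign of $Q(r)$, where $$Q(x)=a_1x^{k-1}+(a_2-d_2)x^{k-2}+(a_3-d_3)x^{k-3}+\cdots+(a_k-d_k),\qquad d_i=\sum_{j=1}^{i-1}a_jc_{i-j}.$$
   Context: A root of a polynomial is principal if it is a positive root of multiplicity one whose magnitude is strictly greater than that of every other root; for $P$ as in the claim it exists and is unique. Binet expansion: if the distinct roots of $P$ are $r_1=r,r_2,\dots,r_j$ with multiplicities $m_1=1,m_2,\dots,m_j$, then every complex sequence satisfying the recurrence can be written uniquely as $a_n=q_1(n)r_1^n+\cdots+q_j(n)r_j^n$ with polynomials $q_i$ of degree at most $m_i-1$; since $r$ is simple, $q_1$ is a constant, called the coefficient attached to $r^n$. The sign of $0$ is $0$. *)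

theory Defs
  imports Complex_Main "HOL-Computational_Algebra.Polynomial"
begin

text \<open>
  The coefficients are \<open>c 1, \<dots>, c k\<close> and sequences start at index 1; values at index 0 are
  never used.
\<close>

definition recurrence_poly :: "nat \<Rightarrow> (nat \<Rightarrow> nat) \<Rightarrow> complex poly" where
  "recurrence_poly k c = monom 1 k - (\<Sum>i=1..k. monom (of_nat (c i)) (k - i))"

definition satisfies_recurrence :: "nat \<Rightarrow> (nat \<Rightarrow> nat) \<Rightarrow> (nat \<Rightarrow> real) \<Rightarrow> bool" where
  "satisfies_recurrence k c a \<longleftrightarrow>
     (\<forall>n\<ge>k. a (n + 1) = (\<Sum>i=1..k. of_nat (c i) * a (n + 1 - i)))"

definition principal_root :: "complex poly \<Rightarrow> real \<Rightarrow> bool" where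
  "principal_root p r \<longleftrightarrow>
     r > 0 \<and> poly p (of_real r) = 0 \<and> order (of_real r) p = 1 \<and>
     (\<forall>z. poly p z = 0 \<and> z \<noteq> of_real r \<longrightarrow> cmod z < r)"

text \<open>
  The family of coefficient polynomials is indexed by the roots themselves; the values of
  \<open>q\<close> away from the roots are irrelevant.
\<close>

definition binet_expansion ::
  "complex poly \<Rightarrow> (nat \<Rightarrow> complex) \<Rightarrow> (complex \<Rightarrow> complex poly) \<Rightarrow> bool" where
  "binet_expansion p a q \<longleftrightarrow>
     (\<forall>z. poly p z = 0 \<longrightarrow> degree (q z) \<le> order z p - 1) \<and>
     (\<forall>n\<ge>1. a n = (\<Sum>z\<in>{z. poly p z = 0}. poly (q z) (of_nat n) * z ^ n))"

definition d_term :: "(nat \<Rightarrow> nat) \<Rightarrow> (nat \<Rightarrow> real) \<Rightarrow> nat \<Rightarrow> real" where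
  "d_term c a i = (\<Sum>j=1..<i. a j * of_nat (c (i - j)))"

text \<open>The leading coefficient is \<open>a 1\<close>, since \<open>d_term c a 1\<close> is an empty sum.\<close>

definition Q_poly :: "nat \<Rightarrow> (nat \<Rightarrow> nat) \<Rightarrow> (nat \<Rightarrow> real) \<Rightarrow> real poly" where
  "Q_poly k c a = (\<Sum>i=1..k. monom (a i - d_term c a i) (k - i))"

end

theory Submission
  imports Defs
begin

text \<open>
  Write \<open>P(x) = (x - r) (b\<^sub>0 x\<^sup>k\<^sup>-\<^sup>1 + \<dots> + b\<^sub>k\<^sub>-\<^sub>1)\<close> by Horner's scheme. Since the shift operator applied
  through \<open>P\<close> annihilates \<open>a\<close>, the linear form \<open>L\<^sub>n = (\<Sum>j=1..k. b\<^sub>k\<^sub>-\<^sub>j a\<^sub>n\<^sub>+\<^sub>j)\<close> satisfies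
  \<open>L\<^sub>n\<^sub>+\<^sub>1 = r L\<^sub>n\<close>, and \<open>L\<^sub>0 = Q(r)\<close>. All other roots being smaller than \<open>r\<close> in modulus,
  \<open>a\<^sub>n / r\<^sup>n\<close> tends to the coefficient \<open>C\<close> of \<open>r\<^sup>n\<close>; dividing \<open>L\<^sub>n = r\<^sup>n Q(r)\<close> by \<open>r\<^sup>n\<close> and letting
  \<open>n\<close> tend to infinity gives \<open>Q(r) = C (\<Sum>j=1..k. b\<^sub>k\<^sub>-\<^sub>j r\<^sup>j)\<close>. Finally every \<open>b\<^sub>i\<close> is positive, because
  \<open>b\<^sub>k = P(r) = 0\<close> and \<open>r b\<^sub>i = b\<^sub>i\<^sub>+\<^sub>1 + c\<^sub>i\<^sub>+\<^sub>1\<close>.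
\<close>

text \<open>The recursion does not involve \<open>k\<close>: entry \<open>i\<close> is the value at
  \<open>r\<close> of the polynomial built from \<open>c 1, ..., c i\<close>. Entry \<open>k\<close>
  is therefore the remainder of the division of P by \<open>x - r\<close>.\<close>

primrec horner_coeff :: "(nat \<Rightarrow> nat) \<Rightarrow> real \<Rightarrow> nat \<Rightarrow> real" where
  "horner_coeff c r 0 = 1"
| "horner_coeff c r (Suc i) = r * horner_coeff c r i - of_nat (c (Suc i))"

lemma poly_recurrence_poly:
  "poly (recurrence_poly k c) z = z ^ k - (\<Sum>i=1..k. of_nat (c i) * z ^ (k - i))"
  by (simp add: recurrence_poly_def poly_monom poly_sum)

lemma poly_recurrence_poly_Suc:
  "poly (recurrence_poly (Suc k) c) z = z * poly (recurrence_poly k c) z - of_nat (c (Suc k))"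
proof -
  have "(\<Sum>i=1..k. of_nat (c i) * z ^ (Suc k - i)) = z * (\<Sum>i=1..k. of_nat (c i) * z ^ (k - i))"
    by (simp add: sum_distrib_left Suc_diff_le mult_ac)
  then show ?thesis
    by (simp add: poly_recurrence_poly algebra_simps)
qed

lemma horner_coeff_eq_poly:
  "of_real (horner_coeff c r k) = poly (recurrence_poly k c) (of_real r)"
proof (induction k)
  case 0
  show ?case by (simp add: poly_recurrence_poly)
next
  case (Suc k)
  then show ?case by (simp add: poly_recurrence_poly_Suc)
qed

lemma horner_coeff_pos:
  assumes "r > 0" and "c k > 0" and "horner_coeff c r k = 0" and "i < k"
  shows "horner_coeff c r i > 0"
proof -
  obtain m where m: "k = Suc m"
    using \<open>i < k\<close> by (cases k) auto
  have "i \<le> m"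
    using \<open>i < k\<close> m by simp
  then show ?thesis
  \<comment> \<open>Downward from \<open>k - 1\<close>, where \<open>c k > 0\<close> gives
    strictness; below that, nonnegativity of \<open>c\<close> suffices.\<close>
  proof (induction rule: inc_induct)
    case base
    have "r * horner_coeff c r m = of_nat (c k)"
      using assms(3) m by simp
    then show ?case
      using assms(1,2) by (metis of_nat_0_less_iff zero_less_mult_pos)
  next
    case (step n)
    then have "r * horner_coeff c r n > 0"
      by (simp add: add_strict_increasing)
    then show ?case
      using assms(1) by (rule zero_less_mult_pos)
  qed
qed

definition horner_form :: "(nat \<Rightarrow> nat) \<Rightarrow> real \<Rightarrow> nat \<Rightarrow> (nat \<Rightarrow> real) \<Rightarrow> real" where
  "horner_form c r n a = (\<Sum>j=1..n. horner_coeff c r (n - j) * a j)"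

text \<open>Each old weight is multiplied by \<open>r\<close> and loses one value of
  \<open>c\<close>; these losses add up to \<open>d_term\<close>. This holds for every
  sequence.\<close>

lemma horner_form_Suc:
  "horner_form c r (Suc n) a = r * horner_form c r n a + a (Suc n) - d_term c a (Suc n)"
proof -
  have "(\<Sum>j=1..n. horner_coeff c r (Suc n - j) * a j)
      = (\<Sum>j=1..n. r * (horner_coeff c r (n - j) * a j) - a j * of_nat (c (Suc n - j)))"
    by (rule sum.cong) (simp_all add: Suc_diff_le algebra_simps)
  then show ?thesis
    by (simp add: horner_form_def d_term_def sum_subtractf sum_distrib_left
        atLeastLessThanSuc_atLeastAtMost)
qed

lemma poly_Q_poly: "poly (Q_poly k c a) r = horner_form c r k a"
proof (induction k)
  case 0
  show ?case by (simp add: Q_poly_def horner_form_def)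
next
  case (Suc k)
  have "(\<Sum>i=1..k. (a i - d_term c a i) * r ^ (Suc k - i))
      = r * (\<Sum>i=1..k. (a i - d_term c a i) * r ^ (k - i))"
    by (simp add: sum_distrib_left Suc_diff_le mult_ac)
  then have "poly (Q_poly (Suc k) c a) r
      = r * poly (Q_poly k c a) r + a (Suc k) - d_term c a (Suc k)"
    by (simp add: Q_poly_def poly_sum poly_monom)
  then show ?case
    by (simp add: Suc horner_form_Suc)
qed

text \<open>The form of length \<open>k + 1\<close> is evaluated twice. When its last term is split
  off, the recurrence makes that term cancel \<open>d_term\<close>; when its first term is split
  off, the weight there is \<open>horner_coeff c r k = 0\<close>, and the shifted form
  remains.\<close>

lemma horner_form_shift:
  assumes root: "horner_coeff c r k = 0" and rec: "satisfies_recurrence k c a"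
  shows "horner_form c r k (\<lambda>j. a (Suc n + j)) = r * horner_form c r k (\<lambda>j. a (n + j))"
proof -
  let ?b = "\<lambda>j. a (n + j)"
  have "a (n + k + 1) = (\<Sum>i=1..k. of_nat (c i) * a (n + k + 1 - i))"
    using rec by (simp add: satisfies_recurrence_def)
  also have "\<dots> = (\<Sum>j=1..k. ?b j * of_nat (c (Suc k - j)))"
    by (rule sum.reindex_bij_witness[where i = "\<lambda>j. Suc k - j" and j = "\<lambda>j. Suc k - j"]) auto
  finally have "?b (Suc k) = d_term c ?b (Suc k)"
    by (simp add: d_term_def atLeastLessThanSuc_atLeastAtMost)
  then have "horner_form c r (Suc k) ?b = r * horner_form c r k ?b"
    by (simp add: horner_form_Suc)
  moreover have "horner_form c r (Suc k) ?b = (\<Sum>j=0..k. horner_coeff c r (k - j) * a (Suc n + j))"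
    unfolding horner_form_def One_nat_def sum.shift_bounds_cl_Suc_ivl by simp
  then have "horner_form c r (Suc k) ?b = horner_form c r k (\<lambda>j. a (Suc n + j))"
    by (simp add: horner_form_def sum.atLeast_Suc_atMost[of 0] root)
  ultimately show ?thesis by simp
qed

lemma horner_form_geometric:
  assumes "horner_coeff c r k = 0" and "satisfies_recurrence k c a"
  shows "horner_form c r k (\<lambda>j. a (n + j)) = r ^ n * horner_form c r k a"
proof (induction n)
  case (Suc n)
  then show ?case
    using horner_form_shift[OF assms, of n] by simp
qed simp

lemma poly_times_power_tendsto_0:
  fixes p :: "complex poly" and w :: complex
  assumes "cmod w < 1"
  shows "(\<lambda>n. poly p (of_nat n) * w ^ n) \<longlonglongrightarrow> 0"
  using assms
proof (induction p arbitrary: w)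
  case (pCons a p)
  \<comment> \<open>Of the two factors \<open>?v ^ n\<close> of \<open>w ^ n\<close>, one absorbs
    \<open>n\<close> and the other goes to the induction hypothesis, which is why \<open>w\<close>
    must be arbitrary.\<close>
  let ?v = "csqrt w"
  have v: "cmod ?v < 1"
    using pCons.prems by (simp add: norm_csqrt)
  have "(\<lambda>n. (of_nat n * ?v ^ n) * (poly p (of_nat n) * ?v ^ n)) \<longlonglongrightarrow> 0 * 0"
    by (intro tendsto_mult powser_times_n_limit_0 pCons.IH v)
  moreover have "(of_nat n * ?v ^ n) * (poly p (of_nat n) * ?v ^ n)
      = of_nat n * poly p (of_nat n) * w ^ n" for n
  proof -
    have "w ^ n = ?v ^ n * ?v ^ n"
      by (metis power2_csqrt power2_eq_square power_mult_distrib)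
    then show ?thesis by simp
  qed
  ultimately have "(\<lambda>n. of_nat n * poly p (of_nat n) * w ^ n) \<longlonglongrightarrow> 0"
    by simp
  moreover have "(\<lambda>n. a * w ^ n) \<longlonglongrightarrow> 0"
    using tendsto_mult_right_zero[OF LIMSEQ_power_zero] pCons.prems by blast
  ultimately have "(\<lambda>n. a * w ^ n + of_nat n * poly p (of_nat n) * w ^ n) \<longlonglongrightarrow> 0 + 0"
    by (rule tendsto_add[rotated])
  then show ?case
    by (simp add: algebra_simps)
qed simp

text \<open>The zero polynomial would have the root \<open>r + 1\<close>, which exceeds
  \<open>r\<close>. This gives finiteness of the root set.\<close>

lemma principal_root_nonzero: "principal_root p r \<Longrightarrow> p \<noteq> 0"
  unfolding principal_root_def by (auto dest!: spec[of _ "of_real (r + 1)"] simp del: of_real_add)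

lemma binet_expansion_tendsto:
  assumes root: "principal_root p r" and binet: "binet_expansion p a q"
  shows "(\<lambda>n. a n / of_real r ^ n) \<longlonglongrightarrow> coeff (q (of_real r)) 0"
proof -
  let ?R = "{z. poly p z = 0}"
  have r: "r > 0" "of_real r \<in> ?R" and small: "\<And>z. z \<in> ?R - {of_real r} \<Longrightarrow> cmod z < r"
    using root by (auto simp: principal_root_def)
  have fin: "finite ?R"
    using principal_root_nonzero[OF root] by (rule poly_roots_finite)
  have "degree (q (of_real r)) = 0"
    using root binet by (force simp: principal_root_def binet_expansion_def)
  then have const: "poly (q (of_real r)) x = coeff (q (of_real r)) 0" for x
    by (auto elim: degree_eq_zeroE)
  have "(\<lambda>n. \<Sum>z\<in>?R - {of_real r}. poly (q z) (of_nat n) * (z / of_real r) ^ n)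
      \<longlonglongrightarrow> (\<Sum>z\<in>?R - {of_real r}. 0)"
    by (intro tendsto_sum poly_times_power_tendsto_0) (use r small in \<open>simp add: norm_divide\<close>)
  then have "(\<lambda>n. coeff (q (of_real r)) 0
      + (\<Sum>z\<in>?R - {of_real r}. poly (q z) (of_nat n) * (z / of_real r) ^ n))
      \<longlonglongrightarrow> coeff (q (of_real r)) 0 + 0"
    by (intro tendsto_add tendsto_const) simp
  \<comment> \<open>The expansion is only given for \<open>n \<ge> 1\<close>, so the two sequences
    agree eventually.\<close>
  moreover have "eventually (\<lambda>n. coeff (q (of_real r)) 0
      + (\<Sum>z\<in>?R - {of_real r}. poly (q z) (of_nat n) * (z / of_real r) ^ n)
      = a n / of_real r ^ n) sequentially"
    using eventually_ge_at_top[of 1]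
  proof eventually_elim
    case (elim n)
    then have "a n = (\<Sum>z\<in>?R. poly (q z) (of_nat n) * z ^ n)"
      using binet by (simp add: binet_expansion_def)
    then have "a n / of_real r ^ n = (\<Sum>z\<in>?R. poly (q z) (of_nat n) * (z / of_real r) ^ n)"
      by (simp add: sum_divide_distrib power_divide)
    then show ?case
      using r by (simp add: sum.remove[OF fin r(2)] const)
  qed
  ultimately show ?thesis
    by (auto dest: Lim_transform_eventually)
qed

theorem theorem1p13:
  fixes k :: nat and c :: "nat \<Rightarrow> nat" and r :: real
    and a :: "nat \<Rightarrow> real" and q :: "complex \<Rightarrow> complex poly"
  assumes "k \<ge> 1"
    and "c k > 0"
    and "Gcd {m \<in> {1..k}. c m \<noteq> 0} = 1"
    and "principal_root (recurrence_poly k c) r"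
    and "satisfies_recurrence k c a"
    and "binet_expansion (recurrence_poly k c) (\<lambda>n. of_real (a n)) q"
  shows "coeff (q (of_real r)) 0 \<in> \<real> \<and>
         sgn (Re (coeff (q (of_real r)) 0)) = sgn (poly (Q_poly k c a) r)"
proof -
  define C where "C = coeff (q (of_real r)) 0"
  let ?S = "\<Sum>j=1..k. horner_coeff c r (k - j) * r ^ j"
  have r: "r > 0" and "poly (recurrence_poly k c) (of_real r) = 0"
    using assms(4) by (simp_all add: principal_root_def)
  then have root: "horner_coeff c r k = 0"
    by (metis horner_coeff_eq_poly of_real_eq_0_iff)
  have lim: "(\<lambda>n. of_real (a n / r ^ n)) \<longlonglongrightarrow> C"
    using binet_expansion_tendsto[OF assms(4,6)] by (simp add: C_def)
  \<comment> \<open>The imaginary parts of the sequence are constantly 0, hence so is their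
    limit.\<close>
  have "C \<in> \<real>"
    using tendsto_Im[OF lim] by (simp add: LIMSEQ_const_iff complex_is_Real_iff)
  have ReC: "(\<lambda>n. a n / r ^ n) \<longlonglongrightarrow> Re C"
    using tendsto_Re[OF lim] by simp
  \<comment> \<open>The factor \<open>r ^ j\<close> compensates the index shift, so that every
    quotient tends to the same limit \<open>Re C\<close>.\<close>
  have "(\<lambda>n. \<Sum>j=1..k. horner_coeff c r (k - j) * r ^ j * (a (n + j) / r ^ (n + j)))
      \<longlonglongrightarrow> (\<Sum>j=1..k. horner_coeff c r (k - j) * r ^ j * Re C)"
    by (intro tendsto_sum tendsto_mult tendsto_const LIMSEQ_ignore_initial_segment ReC)
  moreover have "(\<Sum>j=1..k. horner_coeff c r (k - j) * r ^ j * (a (n + j) / r ^ (n + j)))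
      = poly (Q_poly k c a) r" for n
  proof -
    have "(\<Sum>j=1..k. horner_coeff c r (k - j) * r ^ j * (a (n + j) / r ^ (n + j)))
        = horner_form c r k (\<lambda>j. a (n + j)) / r ^ n"
      using r by (simp add: horner_form_def sum_divide_distrib power_add field_simps)
    then show ?thesis
      using r horner_form_geometric[OF root assms(5), of n] by (simp add: poly_Q_poly)
  qed
  ultimately have "poly (Q_poly k c a) r = ?S * Re C"
    by (simp add: LIMSEQ_const_iff sum_distrib_right)
  \<comment> \<open>The sum is nonempty by \<open>k \<ge> 1\<close>, and \<open>j \<ge> 1\<close>
    keeps the index \<open>k - j\<close> below \<open>k\<close>, where the weights are
    positive.\<close>
  moreover have "?S > 0"
    using assms(1) r by (intro sum_pos mult_pos_pos horner_coeff_pos[OF r assms(2) root]) auto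
  ultimately have "sgn (Re C) = sgn (poly (Q_poly k c a) r)"
    by (simp add: sgn_mult)
  with \<open>C \<in> \<real>\<close> show ?thesis
    by (simp add: C_def)
qed

end
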